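(* Let $\kappa=2^{\omega}$ and let $f:\mathbb{R}\rightarrow\mathcal{P}(\mathbb{R})$ be $\kappa$-reasonable, i.e., $f$ satisfies $C(\kappa,\omega)$ and $C(\omega,\kappa)$. If the strong polarized relation $\binom{\kappa}{\omega}\rightarrow\binom{\kappa}{\omega}^{1,1}_2$ holds, then there exists a subset of $\mathbb{R}$ which is free for $f$ and everywhere dense in $\mathbb{R}$ (with respect to the usual topology).
   Context: Free sets: for a set $S$ and a function $f:S\rightarrow\mathcal{P}(S)$, a set $A\subseteq S$ is free for $f$ iff $x\notin f(y)$ for all distinct $x,y\in A$. Intersection property: for a function $f:S\rightarrow\mathcal{P}(S)$ and cardinals $\lambda,\mu$, $f$ satisfies $C(\lambda,\mu)$ iff $|\bigcap\{f(x):x\in T\}|<\mu$ for every $T\subseteq S$ with $|T|=\lambda$. (Here $\omega$ is identified with the cardinal $\aleph_0$, so "$<\omega$" means finite.) Cardinal notation: $2^{\omega}$ denotes the cardinality of the continuum. Strong polarized relation: $\binom{\lambda}{\kappa}\rightarrow\binom{\lambda}{\kappa}^{1,1}_2$ holds iff for every coloring $c:\lambda\times\kappa\rightarrow 2$ there are $A\subseteq\lambda$ and $B\subseteq\kappa$ such that $|A|=\lambda$, $|B|=\kappa$ and $c\upharpoonright(A\times B)$ is constant. (The relation in the claim is the case in which the top cardinal is $\kappa=2^\omega$ and the bottom one is $\omega$.) *)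

theory Defs
  imports "HOL-Analysis.Analysis"
begin

unbundle cardinal_syntax

text \<open>
  Cardinals are represented by cardinal orders, up to \<open>=o\<close>: \<^const>\<open>natLeq\<close> is
  \<open>\<omega>\<close>. Set mappings \<open>f : S \<rightarrow> P(S)\<close> are total functions on a type, whose
  universe plays the role of \<open>S\<close>.
\<close>

definition free_for :: "('a \<Rightarrow> 'a set) \<Rightarrow> 'a set \<Rightarrow> bool" where
  "free_for f A \<longleftrightarrow> (\<forall>x\<in>A. \<forall>y\<in>A. x \<noteq> y \<longrightarrow> x \<notin> f y)"

definition intersection_property :: "('a \<Rightarrow> 'a set) \<Rightarrow> 'l rel \<Rightarrow> 'm rel \<Rightarrow> bool" where
  "intersection_property f l m \<longleftrightarrow> (\<forall>T. |T| =o l \<longrightarrow> |\<Inter>x\<in>T. f x| <o m)"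

definition reasonable :: "'k rel \<Rightarrow> ('a \<Rightarrow> 'a set) \<Rightarrow> bool" where
  "reasonable k f \<longleftrightarrow>
     intersection_property f k natLeq \<and> intersection_property f natLeq k"

text \<open>
  The strong polarized relation with top cardinal \<open>l\<close> and bottom cardinal \<open>k\<close>;
  a cardinal order is identified with its field, and \<^typ>\<open>bool\<close> is the set of
  two colours.
\<close>

definition strong_polarized :: "'l rel \<Rightarrow> 'k rel \<Rightarrow> bool" where
  "strong_polarized l k \<longleftrightarrow>
     (\<forall>c :: 'l \<Rightarrow> 'k \<Rightarrow> bool.
        \<exists>A B. A \<subseteq> Field l \<and> B \<subseteq> Field k \<and> |A| =o l \<and> |B| =o k \<and>
          (\<exists>i. \<forall>a\<in>A. \<forall>b\<in>B. c a b = i))"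

abbreviation continuum :: "(nat \<Rightarrow> bool) rel" where
  "continuum \<equiv> ctwo ^c natLeq"

end

theory Submission imports Defs begin

text \<open>
  Call \<open>x\<close> and \<open>y\<close> independent if neither lies in the image of the other. Two applications of
  the polarized relation show that inside a set \<open>X\<close> of size \<open>\<kappa>\<close> and a countably infinite set
  \<open>D\<close> there are \<open>X' \<subseteq> X\<close> of size \<open>\<kappa>\<close> and an infinite \<open>D' \<subseteq> D\<close> such that all
  pairs in \<open>D' \<times> X'\<close> are independent: the other colour is excluded, the first time by
  \<open>C(\<kappa>, \<omega>)\<close> and the second time by \<open>C(\<omega>, \<kappa>)\<close>. Hence, for fixed \<open>X\<close>, all but finitely many
  \<open>d\<close> are independent of \<open>\<kappa>\<close> many elements of \<open>X\<close>. Since \<open>\<kappa>\<close> is uncountable, a single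
  \<open>d\<close> in a set of size \<open>\<kappa>\<close> serves countably many sets \<open>X\<close> at once. Therefore points of the
  free set can be chosen recursively from the basic open sets, shrinking each of the
  remaining ones to a subset of size \<open>\<kappa>\<close> at every step.
\<close>

definition independent_pair :: "('a \<Rightarrow> 'a set) \<Rightarrow> 'a \<Rightarrow> 'a \<Rightarrow> bool" where
  "independent_pair f x y \<longleftrightarrow> x \<notin> f y \<and> y \<notin> f x"

text \<open>The relation speaks only of the fields of \<open>l\<close> and \<open>k\<close>.
  Bijections from these onto \<open>X\<close> and \<open>D\<close> pull \<open>P\<close> back to a
  colouring and carry its homogeneous sets forward.\<close>

lemma strong_polarized_homogeneous:
  fixes P :: "'a \<Rightarrow> 'b \<Rightarrow> bool" and l :: "'l rel" and k :: "'k rel"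
  assumes sp: "strong_polarized l k" and "Card_order l" "Card_order k"
    and X: "|X| =o l" and D: "|D| =o k"
  obtains X' D' i where "X' \<subseteq> X" "D' \<subseteq> D" "|X'| =o l" "|D'| =o k"
    "\<And>x d. x \<in> X' \<Longrightarrow> d \<in> D' \<Longrightarrow> P x d = i"
proof -
  have "|Field l| =o |X|" "|Field k| =o |D|"
    using assms by (meson card_of_Field_ordIso ordIso_symmetric ordIso_transitive)+
  then obtain g h where g: "bij_betw g (Field l) X" and h: "bij_betw h (Field k) D"
    by (meson card_of_ordIso)
  obtain A B i where AB: "A \<subseteq> Field l" "B \<subseteq> Field k" "|A| =o l" "|B| =o k"
    and hom: "\<forall>a\<in>A. \<forall>b\<in>B. P (g a) (h b) = i"
    using sp[unfolded strong_polarized_def, rule_format, of "\<lambda>a b. P (g a) (h b)"] by blast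
  have "bij_betw g A (g ` A)" "bij_betw h B (h ` B)"
    using g h AB by (meson bij_betw_subset)+
  then have "|A| =o |g ` A|" "|B| =o |h ` B|"
    by (meson card_of_ordIso)+
  then have "|g ` A| =o l" "|h ` B| =o k"
    using AB by (meson ordIso_symmetric ordIso_transitive)+
  moreover have "g ` A \<subseteq> X" "h ` B \<subseteq> D"
    using g h AB by (auto simp: bij_betw_def)
  ultimately show thesis
    using that[of "g ` A" "h ` B" i] hom by blast
qed

lemma infinite_if_ordIso_natLeq: "|D| =o natLeq \<Longrightarrow> infinite D"
  using infinite_iff_natLeq_ordLeq ordIso_iff_ordLeq by blast

lemma reasonable_cofinite_independent:
  fixes l :: "'l rel"
  assumes "reasonable l f" and sp: "strong_polarized l natLeq" and l: "Card_order l"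
    and X: "|X| =o l"
  shows "finite {d. \<not> |{x \<in> X. independent_pair f d x}| =o l}" (is "finite ?E")
proof (rule ccontr)
  assume "infinite ?E"
  then obtain g :: "nat \<Rightarrow> 'a" where g: "inj g" "range g \<subseteq> ?E"
    using infinite_countable_subset by blast
  define D where "D = range g"
  have "|UNIV :: nat set| =o |D|"
    unfolding D_def using g(1) by (intro card_of_ordIsoI[of g] inj_on_imp_bij_betw)
  then have D: "D \<subseteq> ?E" "|D| =o natLeq"
    using g(2) ordIso_transitive[OF ordIso_symmetric card_of_nat] by (simp_all add: D_def)
  from assms(1) have C1: "|T| =o l \<Longrightarrow> finite (\<Inter>x\<in>T. f x)"
    and C2: "|T| =o natLeq \<Longrightarrow> |\<Inter>x\<in>T. f x| <o l" for T
    unfolding reasonable_def intersection_property_def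
    using finite_iff_ordLess_natLeq by auto
  obtain X1 D1 i where 1: "X1 \<subseteq> X" "D1 \<subseteq> D" "|X1| =o l" "|D1| =o natLeq"
    "\<And>x d. x \<in> X1 \<Longrightarrow> d \<in> D1 \<Longrightarrow> (d \<in> f x) = i"
    using strong_polarized_homogeneous[OF sp l natLeq_Card_order X D(2), of "\<lambda>x d. d \<in> f x"]
    by blast
  \<comment> \<open>Colour \<open>True\<close> would put the infinite set \<open>D1\<close> inside
    an intersection that \<open>C1\<close> makes finite.\<close>
  have "\<not> D1 \<subseteq> (\<Inter>x\<in>X1. f x)"
    using C1[OF 1(3)] infinite_if_ordIso_natLeq[OF 1(4)] finite_subset by blast
  then have "\<not> i" using 1(5) by blast
  obtain X2 D2 j where 2: "X2 \<subseteq> X1" "D2 \<subseteq> D1" "|X2| =o l" "|D2| =o natLeq"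
    "\<And>x d. x \<in> X2 \<Longrightarrow> d \<in> D2 \<Longrightarrow> (x \<in> f d) = j"
    using strong_polarized_homogeneous[OF sp l natLeq_Card_order 1(3,4), of "\<lambda>x d. x \<in> f d"]
    by blast
  have "\<not> X2 \<subseteq> (\<Inter>d\<in>D2. f d)"
  proof
    assume "X2 \<subseteq> (\<Inter>d\<in>D2. f d)"
    then have "|X2| <o l"
      using C2[OF 2(4)] card_of_mono1 ordLeq_ordLess_trans by blast
    with 2(3) show False using not_ordLess_ordIso by blast
  qed
  then have "\<not> j" using 2(5) by blast
  obtain d where d: "d \<in> D2"
    using infinite_if_ordIso_natLeq[OF 2(4)] by fastforce
  \<comment> \<open>Both colours are now \<open>False\<close>, so \<open>X2\<close> shows that
    \<open>d\<close> is not exceptional, although \<open>D2\<close> was chosen inside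
    \<open>?E\<close>.\<close>
  have "X2 \<subseteq> {x \<in> X. independent_pair f d x}"
    using 1 2 d \<open>\<not> i\<close> \<open>\<not> j\<close> unfolding independent_pair_def by blast
  then have "l \<le>o |{x \<in> X. independent_pair f d x}|"
    using 2(3) card_of_mono1 ordIso_ordLeq_trans ordIso_symmetric by blast
  moreover have "|{x \<in> X. independent_pair f d x}| \<le>o l"
    using X card_of_mono1[of "{x \<in> X. independent_pair f d x}" X] ordLeq_ordIso_trans by blast
  ultimately have "|{x \<in> X. independent_pair f d x}| =o l"
    by (simp add: ordIso_iff_ordLeq)
  with d 2 1 D show False by blast
qed

text \<open>One step of the recursion: each \<open>S (Suc m)\<close> has only finitely many
  exceptional points, so together they are countable and cannot cover \<open>S 0\<close>.\<close>

lemma reasonable_shrink: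
  fixes S :: "nat \<Rightarrow> 'a set" and l :: "'l rel"
  assumes "reasonable l f" "strong_polarized l natLeq" "Card_order l" and "natLeq <o l"
    and S: "\<And>m. |S m| =o l"
  obtains x where "x \<in> S 0" "\<And>m. |{y \<in> S (Suc m). independent_pair f x y}| =o l"
proof -
  let ?E = "\<lambda>m. {d. \<not> |{x \<in> S (Suc m). independent_pair f d x}| =o l}"
  have "finite (?E m)" for m
    by (rule reasonable_cofinite_independent[OF assms(1-3) S])
  then have "countable (\<Union>m. ?E m)"
    by (intro countable_UN countable_finite countableI_type)
  then have "|\<Union>m. ?E m| \<le>o |UNIV :: nat set|"
    unfolding countable_def card_of_ordLeq[symmetric] by blast
  then have "|\<Union>m. ?E m| \<le>o natLeq"
    using card_of_nat ordLeq_ordIso_trans by blast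
  then have "|\<Union>m. ?E m| <o |S 0|"
    using assms(4) S[of 0] ordIso_symmetric ordLeq_ordLess_trans ordLess_ordIso_trans by blast
  then have "\<not> S 0 \<subseteq> (\<Union>m. ?E m)"
    using card_of_mono1 not_ordLess_ordLeq by blast
  then show thesis using that by blast
qed

lemma reasonable_free_transversal:
  fixes I :: "nat \<Rightarrow> 'a set" and l :: "'l rel"
  assumes asm: "reasonable l f" "strong_polarized l natLeq" "Card_order l" "natLeq <o l"
    and I: "\<And>n. |I n| =o l"
  obtains x where "\<And>n. x n \<in> I n" "free_for f (range x)"
proof -
  \<comment> \<open>\<open>S n m\<close> is what is left of \<open>I (n + m)\<close> at stage
    \<open>n\<close>. Each stage picks a point from the head \<open>S n 0\<close> and drops it,
    which shifts the index by one.\<close>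
  have "\<exists>S. \<forall>n. (\<forall>m. |S n m| =o l \<and> S n m \<subseteq> I (n + m)) \<and>
      (\<exists>x\<in>S n 0. \<forall>m. S (Suc n) m \<subseteq> {y \<in> S n (Suc m). independent_pair f x y})"
  proof (rule dependent_nat_choice)
    show "\<exists>S. \<forall>m. |S m| =o l \<and> S m \<subseteq> I (0 + m)"
      using I by (intro exI[of _ I]) simp
  next
    fix S n
    assume S: "\<forall>m. |S m| =o l \<and> S m \<subseteq> I (n + m)"
    then obtain x where x: "x \<in> S 0" "\<And>m. |{y \<in> S (Suc m). independent_pair f x y}| =o l"
      using reasonable_shrink[OF asm, of S] by blast
    moreover have "{y \<in> S (Suc m). independent_pair f x y} \<subseteq> I (Suc n + m)" for m
      using S[rule_format, of "Suc m"] by auto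
    ultimately show "\<exists>S'. (\<forall>m. |S' m| =o l \<and> S' m \<subseteq> I (Suc n + m)) \<and>
        (\<exists>x\<in>S 0. \<forall>m. S' m \<subseteq> {y \<in> S (Suc m). independent_pair f x y})"
      by (intro exI[of _ "\<lambda>m. {y \<in> S (Suc m). independent_pair f x y}"]) blast
  qed
  then obtain S where SI: "\<And>n m. S n m \<subseteq> I (n + m)"
    and "\<forall>n. \<exists>x\<in>S n 0. \<forall>m. S (Suc n) m \<subseteq> {y \<in> S n (Suc m). independent_pair f x y}"
    by blast
  then obtain x where x: "\<And>n. x n \<in> S n 0"
    and S: "\<And>n m. S (Suc n) m \<subseteq> {y \<in> S n (Suc m). independent_pair f (x n) y}"
    by metis
  have mono: "S (n + k) m \<subseteq> S n (k + m)" for n k m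
  proof (induction k arbitrary: m)
    case (Suc k)
    show ?case using S[of "n + k" m] Suc[of "Suc m"] by auto
  qed simp
  \<comment> \<open>By \<open>mono\<close>, the later point lies in \<open>S (Suc n) k\<close>,
    which stage \<open>n\<close> made independent of \<open>x n\<close>.\<close>
  have "independent_pair f (x n) (x (Suc n + k))" for n k
    using x[of "Suc n + k"] mono[of "Suc n" k 0] S[of n k] by auto
  then have lt: "independent_pair f (x n) (x m)" if "n < m" for n m
    using that less_iff_Suc_add by auto
  have "free_for f (range x)"
    unfolding free_for_def
  proof (clarify)
    fix n m assume "x n \<noteq> x m" "x n \<in> f (x m)"
    then show False
      using lt[of n m] lt[of m n] unfolding independent_pair_def by (metis linorder_neqE_nat)
  qed
  moreover have "x n \<in> I n" for n
    using x[of n] SI[of n 0] by auto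
  ultimately show thesis using that by blast
qed

lemma card_of_real_continuum: "|UNIV :: real set| =o continuum"
proof -
  have "|UNIV :: real set| =o |Pow (UNIV :: nat set)|"
    using nat_sets_eqpoll_reals eqpoll_iff_card_of_ordIso ordIso_symmetric by (metis Pow_UNIV)
  also have "|Pow (UNIV :: nat set)| =o continuum"
    using card_of_Pow_Func[of "UNIV :: nat set"]
    by (simp add: cexp_def ctwo_def Field_natLeq Field_card_of)
  finally show ?thesis .
qed

lemma card_of_open_real:
  fixes U :: "real set"
  assumes "open U" "U \<noteq> {}"
  shows "|U| =o continuum"
proof -
  obtain a e where "ball a e \<subseteq> U" "e > 0"
    using assms openE by blast
  then have "{a <..< a + e} \<subseteq> U" "a < a + e"
    by (auto simp: dist_real_def subset_iff)
  then have "U \<approx> (UNIV :: real set)"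
    by (intro eqpoll_real_subset[of a "a + e"]) auto
  then show ?thesis
    using card_of_real_continuum eqpoll_iff_card_of_ordIso ordIso_transitive by blast
qed

theorem theorem2p4:
  fixes f :: "real \<Rightarrow> real set"
  assumes "reasonable continuum f"
    and "strong_polarized continuum natLeq"
  shows "\<exists>A. free_for f A \<and> closure A = UNIV"
proof -
  obtain B :: "real set set" where B: "countable B" "topological_basis B"
    using ex_countable_basis by blast
  \<comment> \<open>The empty set is removed because every \<open>I n\<close> must have size
    continuum; repetitions in the enumeration are harmless.\<close>
  define I where "I = from_nat_into (B - {{}})"
  have "B - {{}} \<noteq> {}"
    using B(2) topological_basisE[of B UNIV "0::real"] by auto
  then have I: "range I = B - {{}}"
    unfolding I_def by (intro range_from_nat_into) (use B in auto)
  have "natLeq <o continuum"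
    by (simp add: ordLess_ctwo_cexp natLeq_Card_order)
  moreover have "|I n| =o continuum" for n
  proof (rule card_of_open_real)
    have "I n \<in> B - {{}}" using I by auto
    then show "open (I n)" "I n \<noteq> {}"
      using B(2) topological_basis_open by auto
  qed
  ultimately obtain x where x: "\<And>n. x n \<in> I n" "free_for f (range x)"
    using reasonable_free_transversal[OF assms Card_order_cexp, of I] by blast
  \<comment> \<open>Each neighbourhood of \<open>y\<close> contains some \<open>I n\<close>, hence
    the point \<open>x n\<close>.\<close>
  have "y \<in> closure (range x)" for y
    unfolding closure_iff_nhds_not_empty
  proof (intro allI impI)
    fix T V :: "real set" assume "V \<subseteq> T" "y \<in> V" "open V"
    then obtain b where "b \<in> B" "y \<in> b" "b \<subseteq> V"
      using topological_basisE[OF B(2)] by metis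
    moreover from this obtain n where "b = I n" using I by blast
    ultimately show "range x \<inter> T \<noteq> {}"
      using x(1)[of n] \<open>V \<subseteq> T\<close> by blast
  qed
  then show ?thesis using x(2) by blast
qed

end
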